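(* Let $\Sigma=\Sigma_1\times\cdots\times\Sigma_\nu$ be the Cartesian product of signed graphs $\Sigma_1,\ldots,\Sigma_\nu$, with underlying graph $G$. The following three statements are equivalent: (i) $\Sigma$ is balanced. (ii) All of $\Sigma_1,\ldots,\Sigma_\nu$ are balanced. (iii) $\Sigma$ and its underlying graph $G$ have the same spectrum. Moreover, when $\Sigma$ is balanced, $\Sigma$ and $G$ have the same energy.
   Context: All graphs are finite, simple and loop-free. A signed graph $\Sigma=(G,\sigma)$ is a graph $G=(V,E)$ (the underlying graph) with a function $\sigma:E\to\{+1,-1\}$. The sign of a cycle is the product of the signs of its edges; $\Sigma$ is balanced if every cycle is positive. The adjacency matrix $A(\Sigma)$ has $(u,v)$ entry $\sigma(uv)$ if $u,v$ are adjacent and $0$ otherwise; an unsigned graph has its usual adjacency matrix. The spectrum of a graph or signed graph is the list of eigenvalues with multiplicities of its adjacency matrix, and its energy is the sum of the absolute values of these eigenvalues. The Cartesian product of signed graphs $\Sigma_i=(V_i,E_i,\sigma_i)$ is the signed graph on $V_1\times\cdots\times V_\nu$ in which $(u_1,\ldots,u_\nu)$ and $(v_1,\ldots,v_\nu)$ are adjacent iff there is an index $i$ with $u_iv_i\in E_i$ and $u_j=v_j$ for all $j\ne i$, such an edge having sign $\sigma_i(u_iv_i)$. *)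

theory Defs
  imports
    "HOL-Library.FuncSet"
    "HOL-Computational_Algebra.Polynomial"
    "Jordan_Normal_Form.Char_Poly"
begin

text \<open>
  An edge is the two-element set of its endpoints; this excludes loops and multiple edges.
  Vertex sets are explicit finite nonempty carriers, so that graphs on different vertex sets
  can share one type.
\<close>

record 'a ugraph =
  verts :: "'a set"
  edges :: "'a set set"

text \<open>The values of \<open>esign\<close> outside the edge set are irrelevant.\<close>

record 'a signed_graph = "'a ugraph" +
  esign :: "'a set \<Rightarrow> int"

definition simple_graph :: "('a, 'b) ugraph_scheme \<Rightarrow> bool" where
  "simple_graph G \<longleftrightarrow>
     finite (verts G) \<and> verts G \<noteq> {} \<and>
     (\<forall>e \<in> edges G. \<exists>u \<in> verts G. \<exists>v \<in> verts G. u \<noteq> v \<and> e = {u, v})"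

definition is_signed_graph :: "'a signed_graph \<Rightarrow> bool" where
  "is_signed_graph S \<longleftrightarrow> simple_graph S \<and> (\<forall>e \<in> edges S. esign S e \<in> {1, -1})"

definition underlying :: "'a signed_graph \<Rightarrow> 'a ugraph" where
  "underlying S = \<lparr>verts = verts S, edges = edges S\<rparr>"

text \<open>
  A cycle is given by the list of its vertices in cyclic order; the edge number \<open>i\<close> joins
  entry \<open>i\<close> to the next one, the last entry being joined to the first.
\<close>

definition cycle_edge :: "'a list \<Rightarrow> nat \<Rightarrow> 'a set" where
  "cycle_edge c i = {c ! i, c ! (Suc i mod length c)}"

definition is_cycle :: "('a, 'b) ugraph_scheme \<Rightarrow> 'a list \<Rightarrow> bool" where
  "is_cycle G c \<longleftrightarrow>
     3 \<le> length c \<and> distinct c \<and> set c \<subseteq> verts G \<and>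
     (\<forall>i < length c. cycle_edge c i \<in> edges G)"

definition cycle_sign :: "'a signed_graph \<Rightarrow> 'a list \<Rightarrow> int" where
  "cycle_sign S c = (\<Prod>i < length c. esign S (cycle_edge c i))"

definition balanced :: "'a signed_graph \<Rightarrow> bool" where
  "balanced S \<longleftrightarrow> (\<forall>c. is_cycle S c \<longrightarrow> cycle_sign S c = 1)"

text \<open>
  To obtain a matrix with rows and columns indexed by natural numbers, the vertices are listed
  in an arbitrary order, which depends on the vertex set only; the characteristic polynomial
  does not depend on that order.
\<close>

definition vertex_list :: "'a set \<Rightarrow> 'a list" where
  "vertex_list V = (SOME vs. distinct vs \<and> set vs = V)"

definition vertex_mat :: "'a set \<Rightarrow> ('a \<Rightarrow> 'a \<Rightarrow> int) \<Rightarrow> complex mat" where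
  "vertex_mat V a =
     mat (card V) (card V) (\<lambda>(i, j). of_int (a (vertex_list V ! i) (vertex_list V ! j)))"

definition adj_mat :: "'a ugraph \<Rightarrow> complex mat" where
  "adj_mat G = vertex_mat (verts G) (\<lambda>u v. if {u, v} \<in> edges G then 1 else 0)"

definition signed_adj_mat :: "'a signed_graph \<Rightarrow> complex mat" where
  "signed_adj_mat S =
     vertex_mat (verts S) (\<lambda>u v. if {u, v} \<in> edges S then esign S {u, v} else 0)"

text \<open>
  Eigenvalues are counted with multiplicity, as roots of the characteristic polynomial over the
  complex numbers. For the symmetric matrices considered here they are real, so that the
  modulus is the usual absolute value.
\<close>

definition eigenvalue_mset :: "complex mat \<Rightarrow> complex multiset" where
  "eigenvalue_mset A = proots (char_poly A)"

definition mat_energy :: "complex mat \<Rightarrow> real" where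
  "mat_energy A = (\<Sum>z \<in># eigenvalue_mset A. cmod z)"

definition graph_spectrum :: "'a ugraph \<Rightarrow> complex multiset" where
  "graph_spectrum G = eigenvalue_mset (adj_mat G)"

definition signed_spectrum :: "'a signed_graph \<Rightarrow> complex multiset" where
  "signed_spectrum S = eigenvalue_mset (signed_adj_mat S)"

definition graph_energy :: "'a ugraph \<Rightarrow> real" where
  "graph_energy G = mat_energy (adj_mat G)"

definition signed_energy :: "'a signed_graph \<Rightarrow> real" where
  "signed_energy S = mat_energy (signed_adj_mat S)"

text \<open>
  The vertices of a product indexed by \<open>{1..n}\<close> are the extensional functions on \<open>{1..n}\<close>.
\<close>

definition product_verts :: "nat \<Rightarrow> (nat \<Rightarrow> 'a signed_graph) \<Rightarrow> (nat \<Rightarrow> 'a) set" where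
  "product_verts n S = (\<Pi>\<^sub>E i \<in> {1..n}. verts (S i))"

definition product_adj_at ::
    "nat \<Rightarrow> (nat \<Rightarrow> 'a signed_graph) \<Rightarrow> nat \<Rightarrow> (nat \<Rightarrow> 'a) \<Rightarrow> (nat \<Rightarrow> 'a) \<Rightarrow> bool" where
  "product_adj_at n S i u v \<longleftrightarrow>
     u \<in> product_verts n S \<and> v \<in> product_verts n S \<and> i \<in> {1..n} \<and>
     {u i, v i} \<in> edges (S i) \<and> (\<forall>j \<in> {1..n} - {i}. u j = v j)"

text \<open>
  The description \<open>THE s\<close> is proper on edges, because the endpoints of an edge determine the
  index in which they differ; see \<open>product_adj_at_unique\<close> and \<open>esign_product\<close> below.
\<close>

definition cart_product :: "nat \<Rightarrow> (nat \<Rightarrow> 'a signed_graph) \<Rightarrow> (nat \<Rightarrow> 'a) signed_graph" where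
  "cart_product n S =
     \<lparr>verts = product_verts n S,
      edges = {{u, v} | u v. \<exists>i. product_adj_at n S i u v},
      esign = (\<lambda>e. THE s. \<exists>u v i. e = {u, v} \<and> product_adj_at n S i u v \<and>
                                    s = esign (S i) {u i, v i})\<rparr>"

lemma simple_graph_edgeD:
  assumes "simple_graph G" "{u, v} \<in> edges G"
  shows "u \<noteq> v"
  using assms unfolding simple_graph_def by (metis doubleton_eq_iff)

lemma product_adj_at_unique:
  assumes wf: "\<And>i. i \<in> {1..n} \<Longrightarrow> is_signed_graph (S i)"
    and 1: "product_adj_at n S i u v" and 2: "product_adj_at n S j u v"
  shows "i = j"
proof (rule ccontr)
  assume "i \<noteq> j"
  with 1 2 have "u i = v i" "i \<in> {1..n}" "{u i, v i} \<in> edges (S i)"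
    by (auto simp: product_adj_at_def)
  with wf[of i] simple_graph_edgeD[of "S i" "u i" "v i"] show False
    by (simp add: is_signed_graph_def)
qed

lemma product_adj_at_sym: "product_adj_at n S i u v \<Longrightarrow> product_adj_at n S i v u"
  by (auto simp: product_adj_at_def insert_commute)

lemma product_edge_iff:
  "{u, v} \<in> edges (cart_product n S) \<longleftrightarrow> (\<exists>i. product_adj_at n S i u v)"
  by (auto simp: cart_product_def doubleton_eq_iff intro: product_adj_at_sym)

lemma esign_product:
  assumes wf: "\<And>i. i \<in> {1..n} \<Longrightarrow> is_signed_graph (S i)"
    and adj: "product_adj_at n S i u v"
  shows "esign (cart_product n S) {u, v} = esign (S i) {u i, v i}"
proof -
  have uniq: "s = esign (S i) {u i, v i}"
    if "\<exists>x y j. {u, v} = {x, y} \<and> product_adj_at n S j x y \<and> s = esign (S j) {x j, y j}" for s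
  proof -
    from that obtain x y j where xy: "{u, v} = {x, y}" "product_adj_at n S j x y"
        and s: "s = esign (S j) {x j, y j}"
      by blast
    from xy(1) have "u = x \<and> v = y \<or> u = y \<and> v = x"
      by (simp only: doubleton_eq_iff)
    with xy(2) have "product_adj_at n S j u v" and eq: "{x j, y j} = {u j, v j}"
      using product_adj_at_sym[of n S j x y] by blast+
    with product_adj_at_unique[OF wf adj] have "i = j" by blast
    with s eq show ?thesis by simp
  qed
  show ?thesis
    unfolding cart_product_def signed_graph.simps ugraph.simps
    by (rule the_equality) (use adj uniq in blast)+
qed

lemma is_signed_graph_product:
  assumes wf: "\<And>i. i \<in> {1..n} \<Longrightarrow> is_signed_graph (S i)"
  shows "is_signed_graph (cart_product n S)"
proof -
  have [simp]: "verts (cart_product n S) = product_verts n S"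
    by (simp add: cart_product_def)
  have fin: "finite (verts (S i))" and ne: "verts (S i) \<noteq> {}" if "i \<in> {1..n}" for i
    using wf[OF that] by (simp_all add: is_signed_graph_def simple_graph_def)
  have "finite (product_verts n S)"
    unfolding product_verts_def by (rule finite_PiE) (use fin in simp_all)
  moreover have "product_verts n S \<noteq> {}"
    unfolding product_verts_def PiE_eq_empty_iff using ne by blast
  moreover have "(\<exists>u \<in> product_verts n S. \<exists>v \<in> product_verts n S. u \<noteq> v \<and> e = {u, v}) \<and>
      esign (cart_product n S) e \<in> {1, -1}" if e: "e \<in> edges (cart_product n S)" for e
  proof -
    from e obtain u v i where uv: "e = {u, v}" "product_adj_at n S i u v"
      by (auto simp: cart_product_def)
    then have *: "i \<in> {1..n}" "{u i, v i} \<in> edges (S i)" "u \<in> product_verts n S"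
        "v \<in> product_verts n S"
      by (auto simp: product_adj_at_def)
    from wf[OF *(1)] have S: "simple_graph (S i)" "esign (S i) {u i, v i} \<in> {1, -1}"
      using *(2) by (simp_all add: is_signed_graph_def)
    have "u \<noteq> v"
      using simple_graph_edgeD[OF S(1) *(2)] by (rule contrapos_nn) (rule fun_cong)
    then have "\<exists>u \<in> product_verts n S. \<exists>v \<in> product_verts n S. u \<noteq> v \<and> e = {u, v}"
      using *(3,4) uv(1) by blast
    moreover have "esign (cart_product n S) e = esign (S i) {u i, v i}"
      unfolding uv(1) by (rule esign_product[OF wf uv(2)])
    ultimately show ?thesis using S(2) by simp
  qed
  ultimately show ?thesis
    unfolding is_signed_graph_def simple_graph_def by simp
qed

end

theory Submission
  imports Defs "Jordan_Normal_Form.Schur_Decomposition"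
begin

text \<open>
  A signed graph is balanced iff every closed walk is positive iff the sign of an edge \<open>uv\<close> is
  \<open>\<theta> u * \<theta> v\<close> for some \<open>\<theta>\<close> with values \<open>1\<close> and \<open>-1\<close>
  (Harary). Such functions multiply to one on a Cartesian product and restrict from the product to
  each fibre, so the product is balanced iff all factors are. The diagonal matrix of \<open>\<theta>\<close>
  conjugates the signed adjacency matrix into the unsigned one, so balanced graphs have the spectrum
  of the underlying graph. Conversely, equal spectra give equal traces of the \<open>k\<close>th powers of the
  two adjacency matrices, that is, the number of closed walks of length \<open>k\<close> equals the sum of their
  signs; hence no closed walk is negative.
\<close>

section \<open>Signed walks and switching functions\<close>

lemma edge_verts:
  assumes "is_signed_graph S" "{u, v} \<in> edges S"
  shows "u \<in> verts S" "v \<in> verts S"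
proof -
  have "\<forall>e \<in> edges S. e \<subseteq> verts S"
    using assms(1) unfolding is_signed_graph_def simple_graph_def by fast
  then have "{u, v} \<subseteq> verts S" using assms(2) by (rule bspec)
  then show "u \<in> verts S" "v \<in> verts S" by simp_all
qed

text \<open>The sign records what balance is about, the length what traces of matrix powers see. The
  empty walk is allowed at every element of the type, vertex or not.\<close>

inductive swalk :: "'a signed_graph \<Rightarrow> nat \<Rightarrow> 'a \<Rightarrow> int \<Rightarrow> 'a \<Rightarrow> bool" for S where
  refl: "swalk S 0 u 1 u"
| step: "swalk S n u s v \<Longrightarrow> {v, w} \<in> edges S \<Longrightarrow> swalk S (Suc n) u (s * esign S {v, w}) w"

lemma swalk_trans:
  assumes "swalk S n u s v" "swalk S m v t w"
  shows "swalk S (n + m) u (s * t) w"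
  using assms(2,1)
proof (induction rule: swalk.induct)
  case (step m v t w x)
  then show ?case using swalk.step[of S "n + m" u "s * t" w x] by (simp add: mult.assoc)
qed simp

lemma swalk_edge: "{u, v} \<in> edges S \<Longrightarrow> swalk S 1 u (esign S {u, v}) v"
  using swalk.step[OF swalk.refl, of u v S] by simp

lemma swalk_sym:
  assumes "swalk S n u s v"
  shows "swalk S n v s u"
  using assms
proof (induction rule: swalk.induct)
  case (step n u s v w)
  have "swalk S 1 w (esign S {v, w}) v"
    using step.hyps(2) swalk_edge[of w v S] by (simp add: insert_commute)
  from swalk_trans[OF this step.IH] show ?case by (simp add: mult.commute)
qed (rule swalk.refl)

lemma swalk_sign:
  assumes "is_signed_graph S" "swalk S n u s v"
  shows "s \<in> {1, -1}"
  using assms(2) assms(1) by (induction rule: swalk.induct) (auto simp: is_signed_graph_def)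

text \<open>With the vertices indexed, a walk can be cut at two positions where \<open>f\<close>
  takes the same value.\<close>

lemma swalk_vertices:
  assumes "swalk S n u s v"
  obtains f where "f 0 = u" "f n = v" "\<And>i. i < n \<Longrightarrow> {f i, f (Suc i)} \<in> edges S"
    "s = (\<Prod>i<n. esign S {f i, f (Suc i)})"
  using assms
proof (induction arbitrary: thesis rule: swalk.induct)
  case (refl u)
  show ?case by (rule refl[of "\<lambda>_. u"]) simp_all
next
  case (step n u s v w)
  from step.IH obtain f where f: "f 0 = u" "f n = v" "\<And>i. i < n \<Longrightarrow> {f i, f (Suc i)} \<in> edges S"
    "s = (\<Prod>i<n. esign S {f i, f (Suc i)})" by blast
  show ?case
    by (rule step.prems[of "f(Suc n := w)"]) (use f step.hyps(2) in \<open>auto simp: less_Suc_eq\<close>)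
qed

lemma swalk_segment:
  assumes "j \<le> k" "\<And>i. i < k \<Longrightarrow> {f i, f (Suc i)} \<in> edges S"
  shows "swalk S (k - j) (f j) (\<Prod>i=j..<k. esign S {f i, f (Suc i)}) (f k)"
  using assms
proof (induction k rule: dec_induct)
  case base
  then show ?case by (simp add: swalk.refl)
next
  case (step k)
  then show ?case
    using swalk.step[of S "k - j" "f j" _ "f k" "f (Suc k)"] by (simp add: Suc_diff_le)
qed

lemma is_cycle_swalk:
  assumes "is_cycle S c"
  shows "swalk S (length c) (c ! 0) (cycle_sign S c) (c ! 0)"
proof -
  \<comment> \<open>Reading the list modulo its length makes the closing edge the last step of the
    walk.\<close>
  let ?f = "\<lambda>i. c ! (i mod length c)"
  have e: "{?f i, ?f (Suc i)} = cycle_edge c i" if "i < length c" for i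
    using that by (simp add: cycle_edge_def)
  have "swalk S (length c - 0) (?f 0) (\<Prod>i=0..<length c. esign S {?f i, ?f (Suc i)}) (?f (length c))"
    by (rule swalk_segment) (use assms e in \<open>auto simp: is_cycle_def\<close>)
  moreover have "(\<Prod>i=0..<length c. esign S {?f i, ?f (Suc i)}) = cycle_sign S c"
    unfolding cycle_sign_def atLeast0LessThan by (rule prod.cong) (simp_all add: cycle_edge_def)
  ultimately show ?thesis by simp
qed

text \<open>A shortest negative closed walk would have distinct vertices, hence be a cycle.\<close>

lemma balanced_closed_swalk:
  assumes wf: "is_signed_graph S" and bal: "balanced S" and "swalk S n u s u"
  shows "s = 1"
  using assms(3)
proof (induction n arbitrary: u s rule: less_induct)
  case (less n)
  obtain f where f: "f 0 = u" "f n = u" and edge: "\<And>i. i < n \<Longrightarrow> {f i, f (Suc i)} \<in> edges S"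
    and s: "s = (\<Prod>i<n. esign S {f i, f (Suc i)})"
    using swalk_vertices[OF less.prems] by blast
  let ?P = "\<lambda>j k. \<Prod>i=j..<k. esign S {f i, f (Suc i)}"
  have loop: "f i \<noteq> f (Suc i)" if "i < n" for i
    using simple_graph_edgeD[OF _ edge[OF that]] wf by (simp add: is_signed_graph_def)
  show ?case
  proof (cases "inj_on f {..<n}")
    case False
    \<comment> \<open>A repeated vertex splits the walk into the closed walk between positions
      \<open>i\<close> and \<open>j\<close> and the closed walk that skips it. Both are shorter than
      \<open>n\<close>, hence positive, and \<open>s\<close> is the product of their signs.\<close>
    then obtain i j where ij: "i < j" "j < n" "f i = f j"
      unfolding inj_on_def by (metis lessThan_iff linorder_neqE_nat)
    have "swalk S (j - i) (f i) (?P i j) (f i)"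
      using swalk_segment[of i j f S] ij edge by simp
    then have mid: "?P i j = 1" using less.IH[of "j - i"] ij by simp
    have "swalk S (i - 0 + (n - j)) u (?P 0 i * ?P j n) u"
      using swalk_trans[OF swalk_segment[of 0 i f S] swalk_segment[of j n f S, folded ij(3)]]
        f ij edge by simp
    then have "?P 0 i * ?P j n = 1" using less.IH[of "i - 0 + (n - j)"] ij by simp
    moreover have "s = ?P 0 i * ?P i j * ?P j n"
      using ij by (simp add: s prod.atLeastLessThan_concat flip: atLeast0LessThan)
    ultimately show ?thesis using mid by simp
  next
    case inj: True
    \<comment> \<open>With distinct vertices, length 1 would be a loop, length 2 runs along one edge
      and back, and length at least 3 gives a cycle.\<close>
    consider "n = 0" | "n = 1" | "n = 2" | "3 \<le> n" by linarith
    then show ?thesis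
    proof cases
      case 1
      then show ?thesis using s by simp
    next
      case 2
      then show ?thesis using loop[of 0] f by simp
    next
      case 3
      then have "f 2 = f 0" using f by simp
      then have "s = esign S {f 0, f 1} * esign S {f 0, f 1}"
        using 3 s by (simp add: numeral_2_eq_2 insert_commute)
      moreover have "esign S {f 0, f 1} \<in> {1, -1}"
        using edge[of 0] 3 wf by (simp add: is_signed_graph_def)
      ultimately show ?thesis by auto
    next
      case 4
      let ?c = "map f [0..<n]"
      have ce: "cycle_edge ?c i = {f i, f (Suc i)}" if "i < n" for i
        using that f by (cases "Suc i = n") (simp_all add: cycle_edge_def)
      have "f i \<in> verts S" if "i < n" for i
        using edge_verts(1)[OF wf edge[OF that]] .
      then have "is_cycle S ?c"
        unfolding is_cycle_def using 4 inj edge ce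
        by (auto simp: distinct_map atLeast0LessThan)
      then have "cycle_sign S ?c = 1" using bal by (simp add: balanced_def)
      then show ?thesis by (simp add: cycle_sign_def s ce)
    qed
  qed
qed

lemma balanced_iff_closed_swalk:
  assumes "is_signed_graph S"
  shows "balanced S \<longleftrightarrow> (\<forall>n u s. swalk S n u s u \<longrightarrow> s = 1)"
  using balanced_closed_swalk[OF assms] is_cycle_swalk unfolding balanced_def by blast

text \<open>This encodes Harary's bipartition: positive edges join vertices of equal value, negative
  edges join vertices of opposite values.\<close>

definition switching :: "'a signed_graph \<Rightarrow> ('a \<Rightarrow> int) \<Rightarrow> bool" where
  "switching S \<theta> \<longleftrightarrow> (\<forall>v. \<theta> v \<in> {1, -1}) \<and>
     (\<forall>u v. {u, v} \<in> edges S \<longrightarrow> esign S {u, v} = \<theta> u * \<theta> v)"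

lemma switching_sign: "switching S \<theta> \<Longrightarrow> \<theta> v \<in> {1, -1}"
  by (simp add: switching_def)

lemma switching_square: "switching S \<theta> \<Longrightarrow> \<theta> v * \<theta> v = 1"
  using switching_sign[of S \<theta> v] by auto

lemma switching_edge: "switching S \<theta> \<Longrightarrow> {u, v} \<in> edges S \<Longrightarrow> esign S {u, v} = \<theta> u * \<theta> v"
  by (simp add: switching_def)

text \<open>Each passage through an inner vertex contributes the square of its value, so only the
  two ends remain.\<close>

lemma switching_swalk:
  assumes "switching S \<theta>" "swalk S n u s v"
  shows "s = \<theta> u * \<theta> v"
  using assms(2)
proof (induction rule: swalk.induct)
  case (refl u)
  then show ?case using switching_square[OF assms(1)] by simp
next
  case (step n u s v w)
  have "s * esign S {v, w} = \<theta> u * (\<theta> v * \<theta> v) * \<theta> w"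
    using step switching_edge[OF assms(1)] by (simp add: mult.assoc)
  then show ?case using switching_square[OF assms(1)] by simp
qed

text \<open>Given balance, fix a root in each connected component and let \<theta> be the sign of
  some walk from the root. An edge together with the chosen walks to its ends forms a closed walk,
  whose positivity determines the sign of the edge.\<close>

lemma balanced_iff_switching:
  assumes wf: "is_signed_graph S"
  shows "balanced S \<longleftrightarrow> (\<exists>\<theta>. switching S \<theta>)"
proof
  assume "\<exists>\<theta>. switching S \<theta>"
  then show "balanced S"
    unfolding balanced_iff_closed_swalk[OF wf] by (metis switching_swalk switching_square)
next
  assume bal: "balanced S"
  define R where "R u v \<longleftrightarrow> (\<exists>n s. swalk S n u s v)" for u v
  define root where "root v = (SOME u. R u v)" for v
  define \<theta> where "\<theta> v = (SOME s. \<exists>n. swalk S n (root v) s v)" for v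
  have "R (root v) v" for v
    unfolding root_def by (rule someI[of _ v]) (auto simp: R_def intro: swalk.refl)
  then have "\<exists>n. swalk S n (root v) (\<theta> v) v" for v
    unfolding \<theta>_def R_def by (rule someI2_ex[OF exE]) blast+
  then obtain len where walk: "swalk S (len v) (root v) (\<theta> v) v" for v by metis
  have "switching S \<theta>"
    unfolding switching_def
  proof (intro conjI allI impI)
    show "\<theta> v \<in> {1, -1}" for v by (rule swalk_sign[OF wf walk])
    fix u v
    assume e: "{u, v} \<in> edges S"
    \<comment> \<open>Adjacent vertices are reachable from the same elements, so the choice operator
      picks the same root for both.\<close>
    have "R x u \<longleftrightarrow> R x v" for x
      unfolding R_def using swalk_edge[OF e] swalk_sym swalk_trans by metis
    then have root: "root v = root u" by (simp add: root_def)
    have "swalk S (len u + 1 + len v) (root u) (\<theta> u * esign S {u, v} * \<theta> v) (root u)"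
      by (rule swalk_trans[OF swalk_trans[OF walk swalk_edge[OF e]] swalk_sym])
        (use walk[of v] root in simp)
    then have "\<theta> u * esign S {u, v} * \<theta> v = 1"
      by (rule balanced_closed_swalk[OF wf bal])
    moreover have "\<theta> u \<in> {1, -1}" "\<theta> v \<in> {1, -1}"
      by (rule swalk_sign[OF wf walk])+
    ultimately show "esign S {u, v} = \<theta> u * \<theta> v" by auto
  qed
  then show "\<exists>\<theta>. switching S \<theta>" by blast
qed

section \<open>Balance of Cartesian products\<close>

lemma balanced_cart_product_iff:
  assumes wf: "\<And>i. i \<in> {1..n} \<Longrightarrow> is_signed_graph (S i)"
  shows "balanced (cart_product n S) \<longleftrightarrow> (\<forall>i \<in> {1..n}. balanced (S i))"
proof
  have wf': "is_signed_graph (cart_product n S)"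
    by (rule is_signed_graph_product) (rule wf)
  assume "balanced (cart_product n S)"
  then obtain \<theta> where \<theta>: "switching (cart_product n S) \<theta>"
    using balanced_iff_switching[OF wf'] by blast
  show "\<forall>i \<in> {1..n}. balanced (S i)"
  proof
    fix i assume i: "i \<in> {1..n}"
    have "verts (cart_product n S) \<noteq> {}"
      using wf' by (simp add: is_signed_graph_def simple_graph_def)
    \<comment> \<open>Varying coordinate \<open>i\<close> of \<open>b\<close> traces out a copy of
      \<open>S i\<close> in the product, to which \<theta> is restricted.\<close>
    then obtain b where b: "b \<in> product_verts n S"
      by (auto simp: cart_product_def)
    have "switching (S i) (\<lambda>x. \<theta> (b(i := x)))"
      unfolding switching_def
    proof (intro conjI allI impI)
      show "\<theta> (b(i := v)) \<in> {1, -1}" for v by (rule switching_sign[OF \<theta>])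
      fix x y
      assume e: "{x, y} \<in> edges (S i)"
      have adj: "product_adj_at n S i (b(i := x)) (b(i := y))"
        using e edge_verts[OF wf[OF i] e] i b
        by (auto simp: product_adj_at_def product_verts_def PiE_iff extensional_def)
      have "esign (S i) {x, y} = esign (cart_product n S) {b(i := x), b(i := y)}"
        using esign_product[OF wf adj] by simp
      also have "\<dots> = \<theta> (b(i := x)) * \<theta> (b(i := y))"
        by (rule switching_edge[OF \<theta>]) (use adj product_edge_iff in blast)
      finally show "esign (S i) {x, y} = \<theta> (b(i := x)) * \<theta> (b(i := y))" .
    qed
    then show "balanced (S i)" using balanced_iff_switching[OF wf[OF i]] by blast
  qed
next
  assume "\<forall>i \<in> {1..n}. balanced (S i)"
  then have "\<forall>i \<in> {1..n}. \<exists>\<theta>. switching (S i) \<theta>"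
    using balanced_iff_switching wf by blast
  then obtain \<theta> where \<theta>: "\<And>i. i \<in> {1..n} \<Longrightarrow> switching (S i) (\<theta> i)" by metis
  let ?\<theta> = "\<lambda>u. \<Prod>i=1..n. \<theta> i (u i)"
  have "switching (cart_product n S) ?\<theta>"
    unfolding switching_def
  proof (intro conjI allI impI)
    \<comment> \<open>Arbitrary index subsets \<open>I\<close> make induction on finite sets
      applicable.\<close>
    have "(\<Prod>i\<in>I. \<theta> i (v i)) \<in> {1, -1}" if "I \<subseteq> {1..n}" for I v
    proof -
      have "finite I" using that by (rule finite_subset) simp
      then show ?thesis using that
      proof induction
        case (insert i I)
        then have "\<theta> i (v i) \<in> {1, -1}" by (intro switching_sign[OF \<theta>]) simp
        with insert show ?case by auto
      qed simp
    qed
    then show "?\<theta> v \<in> {1, -1}" for v by blast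
    fix u v
    assume "{u, v} \<in> edges (cart_product n S)"
    then obtain i where adj: "product_adj_at n S i u v" by (auto simp: product_edge_iff)
    then have i: "i \<in> {1..n}" and e: "{u i, v i} \<in> edges (S i)"
      and other: "\<And>j. j \<in> {1..n} - {i} \<Longrightarrow> u j = v j"
      by (auto simp: product_adj_at_def)
    have "?\<theta> u * ?\<theta> v = (\<Prod>j=1..n. \<theta> j (u j) * \<theta> j (v j))"
      by (simp add: prod.distrib)
    also have "\<dots> = \<theta> i (u i) * \<theta> i (v i) * (\<Prod>j\<in>{1..n} - {i}. \<theta> j (u j) * \<theta> j (v j))"
      using i by (simp add: prod.remove)
    \<comment> \<open>The ends of the edge agree in every other coordinate, so these factors are
      squares of signs.\<close>
    also have "(\<Prod>j\<in>{1..n} - {i}. \<theta> j (u j) * \<theta> j (v j)) = 1"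
      by (rule prod.neutral) (use other switching_square[OF \<theta>] in simp)
    also have "\<theta> i (u i) * \<theta> i (v i) = esign (S i) {u i, v i}"
      using switching_edge[OF \<theta>[OF i] e] by simp
    finally show "esign (cart_product n S) {u, v} = ?\<theta> u * ?\<theta> v"
      using esign_product[OF wf adj] by simp
  qed
  moreover have "is_signed_graph (cart_product n S)"
    by (rule is_signed_graph_product) (rule wf)
  ultimately show "balanced (cart_product n S)"
    using balanced_iff_switching by blast
qed

section \<open>Traces of powers and the characteristic polynomial\<close>

definition trace_mat :: "'a::comm_ring_1 mat \<Rightarrow> 'a" where
  "trace_mat A = (\<Sum>i<dim_row A. A $$ (i, i))"

lemma trace_mat_mult_comm:
  assumes "A \<in> carrier_mat n m" "B \<in> carrier_mat m n"
  shows "trace_mat (A * B) = trace_mat (B * A)"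
proof -
  have "trace_mat (A * B) = (\<Sum>i<n. \<Sum>j<m. A $$ (i, j) * B $$ (j, i))"
    using assms by (auto simp: trace_mat_def scalar_prod_def atLeast0LessThan)
  also have "\<dots> = (\<Sum>j<m. \<Sum>i<n. B $$ (j, i) * A $$ (i, j))"
    by (subst sum.swap) (simp add: mult.commute)
  also have "\<dots> = trace_mat (B * A)"
    using assms by (auto simp: trace_mat_def scalar_prod_def atLeast0LessThan)
  finally show ?thesis .
qed

lemma trace_mat_similar:
  assumes "similar_mat_wit A B P Q"
  shows "trace_mat A = trace_mat B"
proof -
  note * = similar_mat_witD[OF HOL.refl assms]
  have "trace_mat A = trace_mat (P * (B * Q))"
    by (subst *(3)) (simp only: assoc_mult_mat[OF *(6,5,7)])
  also have "\<dots> = trace_mat (B * Q * P)"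
    by (rule trace_mat_mult_comm[OF *(6) mult_carrier_mat[OF *(5,7)]])
  also have "B * Q * P = B"
    unfolding assoc_mult_mat[OF *(5,7,6)] *(2) by (rule right_mult_one_mat[OF *(5)])
  finally show ?thesis .
qed

lemma upper_triangular_pow:
  fixes A :: "'a::comm_ring_1 mat"
  assumes A: "A \<in> carrier_mat n n" and ut: "upper_triangular A"
  shows "j \<le> i \<Longrightarrow> i < n \<Longrightarrow> (A ^\<^sub>m k) $$ (i, j) = (if i = j then A $$ (i, i) ^ k else 0)"
proof (induction k arbitrary: i j)
  case 0
  then show ?case using A by simp
next
  case (Suc k)
  have P: "A ^\<^sub>m k \<in> carrier_mat n n" using A by (rule pow_carrier_mat)
  have "(A ^\<^sub>m Suc k) $$ (i, j) = (\<Sum>l<n. (A ^\<^sub>m k) $$ (i, l) * A $$ (l, j))"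
    using Suc.prems A P by (simp add: scalar_prod_def atLeast0LessThan)
  \<comment> \<open>For \<open>l < i\<close> the entry of the power lies below the diagonal, and for
    \<open>l > i\<close> we have \<open>l > j\<close>, so the entry of \<open>A\<close> does. Only
    \<open>l = i\<close> survives.\<close>
  also have "\<dots> = (\<Sum>l<n. if l = i then A $$ (i, i) ^ k * A $$ (i, j) else 0)"
  proof (rule sum.cong)
    fix l assume l: "l \<in> {..<n}"
    consider "l < i" | "l = i" | "i < l" by linarith
    then show "(A ^\<^sub>m k) $$ (i, l) * A $$ (l, j) = (if l = i then A $$ (i, i) ^ k * A $$ (i, j) else 0)"
      using Suc.IH[of l i] Suc.prems upper_triangularD[OF ut, of j l] l A by cases auto
  qed simp
  also have "\<dots> = A $$ (i, i) ^ k * A $$ (i, j)" using Suc.prems by simp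
  also have "\<dots> = (if i = j then A $$ (i, i) ^ Suc k else 0)"
    using upper_triangularD[OF ut, of j i] Suc.prems A by auto
  finally show ?case .
qed

text \<open>By Schur decomposition, \<open>A\<close> is similar to an upper triangular matrix with
  diagonal \<open>es\<close>. Similarity passes to powers and preserves the trace, and powers of a
  triangular matrix have the powers of the diagonal entries on the diagonal.\<close>

lemma trace_mat_pow_factorized:
  fixes A :: "complex mat"
  assumes A: "A \<in> carrier_mat n n" and cp: "char_poly A = (\<Prod>e\<leftarrow>es. [:- e, 1:])"
  shows "trace_mat (A ^\<^sub>m k) = (\<Sum>e\<leftarrow>es. e ^ k)"
proof -
  obtain B P Q where "schur_decomposition A es = (B, P, Q)" by (rule prod_cases3)
  from schur_decomposition[OF A cp this]
  have sim: "similar_mat_wit A B P Q" and ut: "upper_triangular B" and diag: "diag_mat B = es"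
    by blast+
  from similar_mat_witD2[OF A sim] have B: "B \<in> carrier_mat n n" by blast
  have "trace_mat (A ^\<^sub>m k) = trace_mat (B ^\<^sub>m k)"
    by (rule trace_mat_similar[OF similar_mat_wit_pow[OF sim]])
  also have "\<dots> = (\<Sum>i<n. (B $$ (i, i)) ^ k)"
    using upper_triangular_pow[OF B ut] B by (simp add: trace_mat_def)
  also have "\<dots> = (\<Sum>e\<leftarrow>es. e ^ k)"
    using B by (simp add: diag_mat_def interv_sum_list_conv_sum_set_nat comp_def atLeast0LessThan
        flip: diag)
  finally show ?thesis .
qed

lemma trace_mat_pow_eqI:
  fixes A B :: "complex mat"
  assumes A: "A \<in> carrier_mat n n" and B: "B \<in> carrier_mat n n"
    and eq: "eigenvalue_mset A = eigenvalue_mset B"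
  shows "trace_mat (A ^\<^sub>m k) = trace_mat (B ^\<^sub>m k)"
proof -
  \<comment> \<open>The two factorizations list their roots in unrelated orders, so the lists are
    compared as multisets; power sums do not depend on the order.\<close>
  have fact: "mset es = eigenvalue_mset C" if "char_poly C = (\<Prod>e\<leftarrow>es. [:- e, 1:])"
    for C :: "complex mat" and es
    unfolding eigenvalue_mset_def that
  proof (induction es)
    case (Cons e es)
    have "(\<Prod>e\<leftarrow>es. [:- e, 1:]) \<noteq> 0" by (auto simp: prod_list_zero_iff)
    then show ?case using Cons.IH proots_mult[of "[:- e, 1:]"] by (simp del: mult_pCons_left)
  qed simp
  obtain as where as: "char_poly A = (\<Prod>e\<leftarrow>as. [:- e, 1:])"
    using char_poly_factorized[OF A] by blast
  obtain bs where bs: "char_poly B = (\<Prod>e\<leftarrow>bs. [:- e, 1:])"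
    using char_poly_factorized[OF B] by blast
  have "mset as = mset bs" using fact[OF as] fact[OF bs] eq by simp
  then have "(\<Sum>e\<leftarrow>as. e ^ k) = (\<Sum>e\<leftarrow>bs. e ^ k)"
    by (metis mset_map sum_mset_sum_list)
  then show ?thesis
    using trace_mat_pow_factorized[OF A as] trace_mat_pow_factorized[OF B bs] by simp
qed

section \<open>Adjacency matrices and walks\<close>

lemma vertex_list:
  assumes "finite V"
  shows "distinct (vertex_list V)" "set (vertex_list V) = V" "length (vertex_list V) = card V"
proof -
  have "\<exists>vs. distinct vs \<and> set vs = V" using finite_distinct_list[OF assms] by blast
  then have "distinct (vertex_list V) \<and> set (vertex_list V) = V"
    unfolding vertex_list_def by (rule someI_ex)
  then show "distinct (vertex_list V)" "set (vertex_list V) = V" by blast+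
  then show "length (vertex_list V) = card V" using distinct_card by fastforce
qed

lemma vertex_list_nth_eq_iff:
  assumes "finite V" "i < card V" "j < card V"
  shows "vertex_list V ! i = vertex_list V ! j \<longleftrightarrow> i = j"
  using assms vertex_list[OF assms(1)] by (simp add: nth_eq_iff_index_eq)

lemma sum_vertex_list:
  assumes "finite V"
  shows "(\<Sum>i<card V. f (vertex_list V ! i)) = (\<Sum>v\<in>V. f v)"
proof -
  have "(\<Sum>v\<in>V. f v) = (\<Sum>v\<leftarrow>vertex_list V. f v)"
    using vertex_list[OF assms] by (metis sum.distinct_set_conv_list)
  also have "\<dots> = (\<Sum>i<card V. f (vertex_list V ! i))"
    using vertex_list[OF assms] by (simp add: sum_list_sum_nth atLeast0LessThan)
  finally show ?thesis ..
qed

lemma vertex_mat_carrier [simp]: "vertex_mat V a \<in> carrier_mat (card V) (card V)"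
  by (simp add: vertex_mat_def)

lemma vertex_mat_dim [simp]: "dim_row (vertex_mat V a) = card V" "dim_col (vertex_mat V a) = card V"
  by (simp_all add: vertex_mat_def)

lemma vertex_mat_cong:
  assumes "finite V" "\<And>u v. u \<in> V \<Longrightarrow> v \<in> V \<Longrightarrow> a u v = b u v"
  shows "vertex_mat V a = vertex_mat V b"
proof (rule eq_matI)
  have "vertex_list V ! i \<in> V" if "i < card V" for i
    using vertex_list[OF assms(1)] that nth_mem by metis
  then show "vertex_mat V a $$ (i, j) = vertex_mat V b $$ (i, j)"
    if "i < dim_row (vertex_mat V b)" "j < dim_col (vertex_mat V b)" for i j
    using that assms(2) by (simp add: vertex_mat_def)
qed simp_all

lemma vertex_mat_one:
  assumes "finite V"
  shows "vertex_mat V (\<lambda>u v. if u = v then 1 else 0) = 1\<^sub>m (card V)"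
  using vertex_list_nth_eq_iff[OF assms] by (intro eq_matI) (auto simp: vertex_mat_def)

text \<open>Matrix products become sums over vertices, so that the enumeration
  \<open>vertex_list\<close> disappears from the walk arguments.\<close>

lemma vertex_mat_mult:
  assumes "finite V"
  shows "vertex_mat V a * vertex_mat V b = vertex_mat V (\<lambda>u w. \<Sum>v\<in>V. a u v * b v w)"
proof (rule eq_matI)
  fix i j
  assume ij: "i < dim_row (vertex_mat V (\<lambda>u w. \<Sum>v\<in>V. a u v * b v w))"
    "j < dim_col (vertex_mat V (\<lambda>u w. \<Sum>v\<in>V. a u v * b v w))"
  then show "(vertex_mat V a * vertex_mat V b) $$ (i, j) =
      vertex_mat V (\<lambda>u w. \<Sum>v\<in>V. a u v * b v w) $$ (i, j)"
    by (simp add: vertex_mat_def scalar_prod_def atLeast0LessThan flip: sum_vertex_list[OF assms])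
qed simp_all

lemma trace_vertex_mat:
  assumes "finite V"
  shows "trace_mat (vertex_mat V a) = of_int (\<Sum>v\<in>V. a v v)"
  by (simp add: trace_mat_def vertex_mat_def flip: sum_vertex_list[OF assms])

text \<open>These are the entries of the matrix powers: sums over walks of the product of the
  weights along the walk. They are kept as integers so that they can be compared by order.\<close>

fun walk_sum :: "'a set \<Rightarrow> ('a \<Rightarrow> 'a \<Rightarrow> int) \<Rightarrow> nat \<Rightarrow> 'a \<Rightarrow> 'a \<Rightarrow> int" where
  "walk_sum V a 0 = (\<lambda>u v. if u = v then 1 else 0)"
| "walk_sum V a (Suc k) = (\<lambda>u w. \<Sum>v\<in>V. walk_sum V a k u v * a v w)"

lemma vertex_mat_pow:
  assumes "finite V"
  shows "vertex_mat V a ^\<^sub>m k = vertex_mat V (walk_sum V a k)"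
  by (induction k) (simp_all add: vertex_mat_one[OF assms] vertex_mat_mult[OF assms])

text \<open>Triangle inequality: the sum of the signs of walks is at most their number in absolute
  value.\<close>

lemma abs_walk_sum_le:
  assumes "\<And>u v. \<bar>a u v\<bar> \<le> b u v"
  shows "\<bar>walk_sum V a k u v\<bar> \<le> walk_sum V b k u v"
proof (induction k arbitrary: v)
  case (Suc k)
  have "\<bar>walk_sum V a (Suc k) u v\<bar> \<le> (\<Sum>x\<in>V. \<bar>walk_sum V a k u x * a x v\<bar>)"
    by (simp add: sum_abs)
  also have "\<dots> \<le> (\<Sum>x\<in>V. walk_sum V b k u x * b x v)"
  proof (rule sum_mono)
    fix x
    show "\<bar>walk_sum V a k u x * a x v\<bar> \<le> walk_sum V b k u x * b x v"
      unfolding abs_mult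
      by (rule mult_mono) (use Suc.IH[of x] assms[of x v] in linarith)+
  qed
  finally show ?case by simp
qed simp

abbreviation adjacency :: "('a, 'b) ugraph_scheme \<Rightarrow> 'a \<Rightarrow> 'a \<Rightarrow> int" where
  "adjacency G \<equiv> \<lambda>u v. if {u, v} \<in> edges G then 1 else 0"

abbreviation signed_adjacency :: "'a signed_graph \<Rightarrow> 'a \<Rightarrow> 'a \<Rightarrow> int" where
  "signed_adjacency S \<equiv> \<lambda>u v. if {u, v} \<in> edges S then esign S {u, v} else 0"

lemma adj_mat_underlying: "adj_mat (underlying S) = vertex_mat (verts S) (adjacency S)"
  by (simp add: adj_mat_def underlying_def)

lemma finite_verts: "is_signed_graph S \<Longrightarrow> finite (verts S)"
  by (simp add: is_signed_graph_def simple_graph_def)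

text \<open>
  Every walk of length \<open>n\<close> contributes its sign to the entry of the \<open>n\<close>th power of the
  signed adjacency matrix, and \<open>1\<close> to that of the unsigned one.
\<close>

lemma swalk_walk_sum:
  assumes wf: "is_signed_graph S" and "swalk S n u s v"
  shows "2 \<le> walk_sum (verts S) (adjacency S) n u v + s * walk_sum (verts S) (signed_adjacency S) n u v"
  using assms(2)
proof (induction rule: swalk.induct)
  case (step n u s v w)
  let ?A = "walk_sum (verts S) (adjacency S) n u"
  let ?B = "walk_sum (verts S) (signed_adjacency S) n u"
  let ?t = "esign S {v, w}"
  \<comment> \<open>The quantity \<open>?A v + s * ?B v\<close> is twice the number of walks of sign
    \<open>s\<close>, whence the bound 2. The term \<open>?f x\<close> is the share of the walks
    with last edge from \<open>x\<close> in the same quantity for sign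
    \<open>s * ?t\<close>.\<close>
  let ?f = "\<lambda>x. ?A x * adjacency S x w + s * ?t * (?B x * signed_adjacency S x w)"
  have s: "s \<in> {1, -1}" using swalk_sign[OF wf step.hyps(1)] .
  have sgn: "esign S e \<in> {1, -1}" if "e \<in> edges S" for e
    using wf that by (simp add: is_signed_graph_def)
  have le: "\<bar>?B x\<bar> \<le> ?A x" for x
    by (rule abs_walk_sum_le) (use sgn in fastforce)
  have nonneg: "0 \<le> ?f x" for x
    using le[of x] s sgn[of "{x, w}"] sgn[OF step.hyps(2)] by auto
  have "2 \<le> ?A v + s * ?B v" by (rule step.IH)
  \<comment> \<open>Here \<open>?t\<close> occurs twice and squares to 1.\<close>
  also have "\<dots> = ?f v" using step.hyps(2) sgn[OF step.hyps(2)] by auto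
  also have "\<dots> \<le> (\<Sum>x\<in>verts S. ?f x)"
    by (rule member_le_sum) (use edge_verts[OF wf step.hyps(2)] nonneg finite_verts[OF wf] in auto)
  finally show ?case by (simp add: sum.distrib sum_distrib_left mult.assoc)
qed simp

section \<open>Balance and the spectrum\<close>

lemma balanced_if_spectrum_eq:
  assumes wf: "is_signed_graph S" and eq: "signed_spectrum S = graph_spectrum (underlying S)"
  shows "balanced S"
  unfolding balanced_iff_closed_swalk[OF wf]
proof (intro allI impI)
  fix n u s
  assume walk: "swalk S n u s u"
  let ?V = "verts S"
  let ?A = "walk_sum ?V (adjacency S) n" and ?B = "walk_sum ?V (signed_adjacency S) n"
  note fin = finite_verts[OF wf]
  have "trace_mat (signed_adj_mat S ^\<^sub>m n) = trace_mat (adj_mat (underlying S) ^\<^sub>m n)"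
    by (rule trace_mat_pow_eqI[of _ "card ?V"])
      (use eq in \<open>simp_all add: signed_adj_mat_def adj_mat_underlying signed_spectrum_def
        graph_spectrum_def\<close>)
  then have "(of_int (\<Sum>v\<in>?V. ?B v v) :: complex) = of_int (\<Sum>v\<in>?V. ?A v v)"
    unfolding signed_adj_mat_def adj_mat_underlying vertex_mat_pow[OF fin] trace_vertex_mat[OF fin] .
  then have sum: "(\<Sum>v\<in>?V. ?B v v) = (\<Sum>v\<in>?V. ?A v v)" by (simp only: of_int_eq_iff)
  have le: "\<bar>?B x y\<bar> \<le> ?A x y" for x y
    by (rule abs_walk_sum_le) (use wf in \<open>fastforce simp: is_signed_graph_def\<close>)
  show "s = 1"
  proof (cases "u \<in> ?V")
    case True
    \<comment> \<open>All diagonal differences are nonnegative and add up to zero, so none is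
      positive. A closed walk of sign -1 at \<open>u\<close> would force a difference of at least
      2.\<close>
    have "?A u u - ?B u u \<le> (\<Sum>v\<in>?V. ?A v v - ?B v v)"
      by (rule member_le_sum[of u ?V "\<lambda>v. ?A v v - ?B v v"])
        (use True fin le in \<open>auto simp: abs_le_iff\<close>)
    also have "\<dots> = 0" using sum by (simp add: sum_subtractf)
    finally have "?A u u \<le> ?B u u" by simp
    then show ?thesis using swalk_walk_sum[OF wf walk] swalk_sign[OF wf walk] by auto
  next
    \<comment> \<open>Outside the vertex set only the empty walk exists, and its sign is 1.\<close>
    case False
    with walk show ?thesis
      by (cases rule: swalk.cases) (use edge_verts[OF wf] in blast)+
  qed
qed

text \<open>The diagonal matrix of \<theta> is its own inverse, and conjugation by it multiplies the
  entry at \<open>u\<close>, \<open>v\<close> by \<open>\<theta> u * \<theta> v\<close>, which is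
  the sign on every edge.\<close>

lemma char_poly_switching:
  assumes wf: "is_signed_graph S" and sw: "switching S \<theta>"
  shows "char_poly (signed_adj_mat S) = char_poly (adj_mat (underlying S))"
proof -
  let ?V = "verts S"
  let ?D = "vertex_mat ?V (\<lambda>u v. if u = v then \<theta> u else 0)"
  note fin = finite_verts[OF wf]
  have delta: "(\<Sum>v\<in>?V. (if u = v then \<theta> u else 0) * g v) = \<theta> u * g u"
    "(\<Sum>v\<in>?V. g v * (if v = u then \<theta> v else 0)) = g u * \<theta> u" if "u \<in> ?V" for u g
    using that fin by (simp_all add: if_distrib[where f = "\<lambda>x. x * _"]
        if_distrib[where f = "\<lambda>x. _ * x"] cong: if_cong)
  have DD: "?D * ?D = 1\<^sub>m (card ?V)"
    unfolding vertex_mat_mult[OF fin] vertex_mat_one[OF fin, symmetric]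
    by (rule vertex_mat_cong[OF fin]) (simp add: delta switching_square[OF sw])
  have "signed_adj_mat S = ?D * adj_mat (underlying S) * ?D"
    unfolding signed_adj_mat_def adj_mat_underlying vertex_mat_mult[OF fin]
    by (rule vertex_mat_cong[OF fin]) (simp add: delta switching_edge[OF sw])
  then have "similar_mat (signed_adj_mat S) (adj_mat (underlying S))"
    by (intro similar_matI[of _ _ ?D ?D "card ?V"])
      (use DD in \<open>auto simp: signed_adj_mat_def adj_mat_underlying intro!: mult_carrier_mat\<close>)
  then show ?thesis by (rule char_poly_similar)
qed

lemma eigenvalue_mset_balanced:
  assumes "is_signed_graph S" "balanced S"
  shows "eigenvalue_mset (signed_adj_mat S) = eigenvalue_mset (adj_mat (underlying S))"
  using assms char_poly_switching balanced_iff_switching unfolding eigenvalue_mset_def by metis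

theorem theorem3p4:
  fixes S :: "nat \<Rightarrow> 'a signed_graph" and \<nu> :: nat
  assumes "1 \<le> \<nu>"
    and "\<And>i. i \<in> {1..\<nu>} \<Longrightarrow> is_signed_graph (S i)"
  defines "\<Sigma> \<equiv> cart_product \<nu> S"
  defines "G \<equiv> underlying \<Sigma>"
  shows "(balanced \<Sigma> \<longleftrightarrow> (\<forall>i \<in> {1..\<nu>}. balanced (S i))) \<and>
         (balanced \<Sigma> \<longleftrightarrow> signed_spectrum \<Sigma> = graph_spectrum G) \<and>
         (balanced \<Sigma> \<longrightarrow> signed_energy \<Sigma> = graph_energy G)"
proof -
  have wf: "is_signed_graph \<Sigma>"
    unfolding \<Sigma>_def by (rule is_signed_graph_product) (rule assms(2))
  have "balanced \<Sigma> \<longleftrightarrow> (\<forall>i \<in> {1..\<nu>}. balanced (S i))"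
    unfolding \<Sigma>_def by (rule balanced_cart_product_iff) (rule assms(2))
  moreover have "balanced \<Sigma>" if "signed_spectrum \<Sigma> = graph_spectrum G"
    using balanced_if_spectrum_eq[OF wf] that by (simp add: G_def)
  \<comment> \<open>Spectrum and energy are both read off the eigenvalue multiset, so one equality
    serves for both.\<close>
  moreover have "signed_spectrum \<Sigma> = graph_spectrum G" "signed_energy \<Sigma> = graph_energy G"
    if "balanced \<Sigma>"
    using eigenvalue_mset_balanced[OF wf that]
    by (simp_all add: G_def signed_spectrum_def graph_spectrum_def signed_energy_def
        graph_energy_def mat_energy_def)
  ultimately show ?thesis by blast
qed

end
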